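(* The relation $[\omega,\omega,2,3]\to 3$ fails; that is, there exist a $2$-almost disjoint family $\mathcal A\subseteq[\omega]^{\omega}$ and a partial function $f$ from $\omega$ to $3=\{0,1,2\}$ with $|A\cap\operatorname{dom}(f)|\le 3$ for every $A\in\mathcal A$, such that there is no function $g:\omega\to 3$ with $g\supseteq f$ which is a conflict free coloring of $\mathcal A$.
   Context: A family is $2$-almost disjoint if any two distinct members have at most one common element. $g:\omega\to 3$ is a conflict free coloring of $\mathcal A$ if for every $A\in\mathcal A$ there is $i<3$ with $|A\cap g^{-1}\{i\}|=1$. In general, $[\lambda,\kappa,d,k]\to x$ denotes: for every $d$-almost disjoint $\mathcal A\subseteq[\lambda]^\kappa$ and every partial function $f$ from $\lambda$ to $x$ with $|A\cap\operatorname{dom}(f)|\le k$ for all $A\in\mathcal A$, there is a conflict free coloring $g:\lambda\to x$ of $\mathcal A$ with $g\supseteq f$. *)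

theory Defs
  imports Main
begin

definition almost_disjoint :: "nat \<Rightarrow> 'a set set \<Rightarrow> bool" where
  "almost_disjoint d \<A> \<longleftrightarrow>
     (\<forall>A\<in>\<A>. \<forall>B\<in>\<A>. A \<noteq> B \<longrightarrow> finite (A \<inter> B) \<and> card (A \<inter> B) < d)"

definition conflict_free :: "nat \<Rightarrow> ('a \<Rightarrow> nat) \<Rightarrow> 'a set set \<Rightarrow> bool" where
  "conflict_free x g \<A> \<longleftrightarrow>
     (\<forall>a. g a < x) \<and> (\<forall>A\<in>\<A>. \<exists>i<x. card (A \<inter> g -` {i}) = 1 \<and> finite (A \<inter> g -` {i}))"

definition arrow_omega :: "nat \<Rightarrow> nat \<Rightarrow> nat \<Rightarrow> bool" where
  "arrow_omega d k x \<longleftrightarrow>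
     (\<forall>\<A> :: nat set set. \<forall>f :: nat \<rightharpoonup> nat.
        (\<forall>A\<in>\<A>. infinite A) \<and> almost_disjoint d \<A> \<and> ran f \<subseteq> {..<x}
        \<and> (\<forall>A\<in>\<A>. finite (A \<inter> dom f) \<and> card (A \<inter> dom f) \<le> k)
        \<longrightarrow> (\<exists>g. conflict_free x g \<A> \<and> (\<forall>a\<in>dom f. f a = Some (g a))))"

end

theory Submission
  imports Defs "HOL-Library.Countable"
begin

text \<open>
  Call the points given a colour by \<open>f\<close> precoloured. A block with at least two points of each of
  two colours must contain exactly one point of the third. Among four points
  \<open>X 0, \<dots>, X 3\<close> two have the same colour, so for each pair \<open>X a, X b\<close> and each colour \<open>c\<close> it suffices
  to exclude that both have colour \<open>c\<close>; let \<open>d\<close> and \<open>e\<close> be the other two colours. A private grid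
  \<open>4 \<times> \<omega>\<close> does so. Its rows are joined to \<open>X a\<close> and to precoloured points \<open>c, e, e\<close>, hence contain
  exactly one \<open>d\<close>. Its columns are joined to \<open>X b\<close> and to precoloured points \<open>c, d, d\<close>, hence contain
  exactly one \<open>e\<close>. Each point of row 0 is assigned its own \<open>3 \<times> 4\<close> window in the other rows, divided
  into four transversals, each joined to this point and to precoloured points \<open>d, e, e\<close>.
  At the point of row 0 with colour \<open>d\<close>, every transversal contains at most one \<open>c\<close>. So the window
  of 12 points has at most 3 points of colour \<open>d\<close>, 4 of colour \<open>e\<close> and 4 of colour \<open>c\<close>,
  which is impossible.
\<close>

section \<open>Transfer from countable point sets to natural numbers\<close>

lemma not_arrow_omegaI:
  fixes \<A> :: "'b::countable set set" and f :: "'b \<rightharpoonup> nat"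
  assumes inf: "\<And>A. A \<in> \<A> \<Longrightarrow> infinite A"
    and ad: "almost_disjoint d \<A>"
    and ran: "ran f \<subseteq> {..<x}"
    and dom: "\<And>A. A \<in> \<A> \<Longrightarrow> finite (A \<inter> dom f) \<and> card (A \<inter> dom f) \<le> k"
    and no: "\<And>g. conflict_free x g \<A> \<Longrightarrow> \<forall>a\<in>dom f. f a = Some (g a) \<Longrightarrow> False"
  shows "\<not> arrow_omega d k x"
proof
  assume arrow: "arrow_omega d k x"
  \<comment> \<open>The counterexample is copied along the injection \<open>to_nat\<close>. Off its
    range \<open>from_nat\<close> is arbitrary, so \<open>F\<close> stays undefined there.\<close>
  define F where "F m = (if m \<in> range (to_nat :: 'b \<Rightarrow> nat) then f (from_nat m) else None)" for m
  define \<B> where "\<B> = image (to_nat :: 'b \<Rightarrow> nat) ` \<A>"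
  have inj: "inj_on (to_nat :: 'b \<Rightarrow> nat) S" for S
    by (rule inj_on_subset[OF inj_to_nat]) simp
  have F [simp]: "F (to_nat p) = f p" for p
    by (simp add: F_def)
  have dom_F: "to_nat ` A \<inter> dom F = to_nat ` (A \<inter> dom f)" for A :: "'b set"
    by (auto simp: dom_def)
  have "\<forall>B\<in>\<B>. infinite B"
    using inf by (auto simp: \<B>_def finite_image_iff[OF inj])
  moreover have "almost_disjoint d \<B>"
    using ad by (auto simp: \<B>_def almost_disjoint_def image_Int[OF inj_to_nat, symmetric]
        finite_image_iff[OF inj] card_image[OF inj])
  moreover have "ran F \<subseteq> {..<x}"
    using ran by (auto simp: ran_def F_def split: if_splits)
  moreover have "\<forall>B\<in>\<B>. finite (B \<inter> dom F) \<and> card (B \<inter> dom F) \<le> k"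
    using dom by (auto simp: \<B>_def dom_F card_image[OF inj])
  ultimately obtain g where g: "conflict_free x g \<B>" and ext: "\<forall>m\<in>dom F. F m = Some (g m)"
    using arrow[unfolded arrow_omega_def, THEN spec[of _ \<B>], THEN spec[of _ F]] by meson
  have fibre: "to_nat ` A \<inter> g -` {i} = to_nat ` (A \<inter> (g \<circ> to_nat) -` {i})" for A :: "'b set" and i
    by auto
  have "conflict_free x (g \<circ> to_nat) \<A>"
    using g by (auto simp: conflict_free_def \<B>_def fibre finite_image_iff[OF inj] card_image[OF inj])
  moreover have "\<forall>a\<in>dom f. f a = Some ((g \<circ> to_nat) a)"
  proof
    fix a assume "a \<in> dom f"
    then have "to_nat a \<in> dom F" by (simp add: dom_def)
    with ext have "F (to_nat a) = Some (g (to_nat a))" by blast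
    then show "f a = Some ((g \<circ> to_nat) a)" by simp
  qed
  ultimately show False by (rule no)
qed

section \<open>Gadgets and precolouring\<close>

text \<open>The arguments \<open>a b c\<close> of a block name the gadget for the pair \<open>X a, X b\<close> and the colour \<open>c\<close>.\<close>

datatype block = Row nat nat nat nat | Col nat nat nat nat | Trans nat nat nat nat nat

instance block :: countable by countable_datatype

datatype point = X nat | Grid nat nat nat nat nat | Private block nat

instance point :: countable by countable_datatype

text \<open>Rows get no uncoloured private points: those could absorb the point of colour \<open>d\<close> that row 0
  must contain.\<close>

fun block_points :: "block \<Rightarrow> point set" where
  "block_points (Row a b c i) =
     insert (X a) (range (Grid a b c i) \<union> Private (Row a b c i) ` {..<3})"
| "block_points (Col a b c n) =
     insert (X b) ((\<lambda>i. Grid a b c i n) ` {..<4} \<union> range (Private (Col a b c n)))"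
| "block_points (Trans a b c n k) =
     insert (Grid a b c 0 n)
       ({Grid a b c i (Suc m) | i m. i \<in> {1..3} \<and> m div 4 = n \<and> (i + m) mod 4 = k}
        \<union> range (Private (Trans a b c n k)))"

text \<open>For \<open>a = b\<close>, a row and a column of one gadget would share
  \<open>X a\<close> besides their common grid point.\<close>

fun valid_block :: "block \<Rightarrow> bool" where
  "valid_block (Row a b c i) \<longleftrightarrow> a < b \<and> c < 3"
| "valid_block (Col a b c n) \<longleftrightarrow> a < b \<and> c < 3"
| "valid_block (Trans a b c n k) \<longleftrightarrow> a < b \<and> c < 3"

text \<open>Modulo 3, \<open>c + 1\<close> is the colour d and \<open>c + 2\<close> the colour e.
  Index 0 gives the colour needed once, indices 1 and 2 the one needed twice.\<close>

fun private_colour :: "block \<Rightarrow> nat \<Rightarrow> nat" where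
  "private_colour (Row a b c i) k = (if k = 0 then c else (c + 2) mod 3)"
| "private_colour (Col a b c n) k = (if k = 0 then c else (c + 1) mod 3)"
| "private_colour (Trans a b c n j) k = (if k = 0 then (c + 1) mod 3 else (c + 2) mod 3)"

text \<open>In columns and transversals, the private points from index 3 on stay uncoloured and only
  make the block infinite.\<close>

fun precolouring :: "point \<rightharpoonup> nat" where
  "precolouring (Private l k) = (if valid_block l \<and> k < 3 then Some (private_colour l k) else None)"
| "precolouring _ = None"

definition blocks :: "point set set" where
  "blocks = block_points ` Collect valid_block"

lemma infinite_block: "infinite (block_points l)"
proof (cases l)
  case (Row a b c i)
  have "infinite (range (Grid a b c i))"
    by (simp add: finite_image_iff inj_on_def)
  then show ?thesis by (simp add: Row)
next
  case (Col a b c n)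
  have "infinite (range (Private (Col a b c n)))"
    by (simp add: finite_image_iff inj_on_def)
  then show ?thesis by (simp add: Col)
next
  case (Trans a b c n k)
  have "infinite (range (Private (Trans a b c n k)))"
    by (simp add: finite_image_iff inj_on_def)
  then show ?thesis by (simp add: Trans)
qed

lemma private_block_unique: "Private l' k \<in> block_points l \<Longrightarrow> l' = l"
  by (cases l) auto

lemma card_precoloured_block:
  "finite (block_points l \<inter> dom precolouring) \<and> card (block_points l \<inter> dom precolouring) \<le> 3"
proof -
  have sub: "block_points l \<inter> dom precolouring \<subseteq> Private l ` {..<3}"
  proof
    fix p assume "p \<in> block_points l \<inter> dom precolouring"
    then show "p \<in> Private l ` {..<3}"
      by (cases p) (auto split: if_splits dest: private_block_unique)
  qed
  have "card (Private l ` {..<3}) \<le> 3"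
    using card_image_le[of "{..<3::nat}" "Private l"] by simp
  with sub show ?thesis
    by (meson card_mono finite_imageI finite_lessThan finite_subset le_trans)
qed

section \<open>Almost disjointness\<close>

lemma mod_4_add_left_cancel:
  fixes i m m' :: nat
  assumes "(i + m) mod 4 = (i + m') mod 4"
  shows "m mod 4 = m' mod 4"
proof -
  \<comment> \<open>Modulo 4, \<open>3 * i\<close> serves as the negative of
    \<open>i\<close>.\<close>
  have "(3 * i + (i + m)) mod 4 = (3 * i + (i + m')) mod 4"
    using assms by (rule mod_add_cong[OF refl])
  moreover have "(3 * i + (i + n)) mod 4 = n mod 4" for n
  proof -
    have "3 * i + (i + n) = n + i * 4" by simp
    then show ?thesis by (simp only: mod_mult_self1)
  qed
  ultimately show ?thesis by (simp only:)
qed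

text \<open>Hence a transversal has at most one window point in each column.\<close>

lemma mod_4_add_right_cancel:
  fixes i i' m :: nat
  assumes "(i + m) mod 4 = (i' + m) mod 4" "i \<le> 3" "i' \<le> 3"
  shows "i = i'"
proof -
  have "(m + i) mod 4 = (m + i') mod 4"
    using assms(1) by (simp only: add.commute)
  then have "i mod 4 = i' mod 4"
    by (rule mod_4_add_left_cancel)
  moreover have "i mod 4 = i" "i' mod 4 = i'"
    using assms(2,3) by simp_all
  ultimately show ?thesis by (simp only:)
qed

text \<open>Hence a transversal has at most one window point in each row.\<close>

lemma div_mod_4_add_left_cancel:
  fixes i m m' :: nat
  assumes "m div 4 = m' div 4" "(i + m) mod 4 = (i + m') mod 4"
  shows "m = m'"
proof -
  have "m = m div 4 * 4 + m mod 4" by (rule div_mult_mod_eq[symmetric])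
  also have "\<dots> = m' div 4 * 4 + m' mod 4"
    by (simp only: assms(1) mod_4_add_left_cancel[OF assms(2)])
  also have "\<dots> = m'" by (rule div_mult_mod_eq)
  finally show ?thesis .
qed

text \<open>The window of point n of row 0 avoids column n, so no column contains both that point
  and a window point of the same transversal.\<close>

lemma Suc_neq_div_4: "Suc m \<noteq> m div 4"
  using div_le_dividend[of m 4] by linarith

lemma Grid_mem_block_iff:
  "Grid a b c i m \<in> block_points l \<longleftrightarrow>
     l = Row a b c i
     \<or> l = Col a b c m \<and> i < 4
     \<or> (\<exists>k. l = Trans a b c m k) \<and> i = 0
     \<or> (\<exists>m'. m = Suc m' \<and> l = Trans a b c (m' div 4) ((i + m') mod 4)) \<and> i \<in> {1..3}"
  by (cases l) auto

lemma X_mem_block_iff: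
  "X v \<in> block_points l \<longleftrightarrow> (\<exists>b c i. l = Row v b c i) \<or> (\<exists>a c n. l = Col a v c n)"
  by (cases l) auto

text \<open>A private point determines its block and a grid point its gadget. No block has two
  \<open>X\<close> points, and the rows and columns of a gadget have different ones. Only pairs of
  grid points need arithmetic.\<close>

lemma blocks_meet_at_most_once:
  assumes "valid_block l" "valid_block l'" "l \<noteq> l'"
    and "p \<in> block_points l" "p \<in> block_points l'" "q \<in> block_points l" "q \<in> block_points l'"
  shows "p = q"
proof (cases p)
  case (Private l'' k)
  then show ?thesis using assms private_block_unique by metis
next
  case p: (X v)
  show ?thesis
  proof (cases q)
    case (X w)
    then show ?thesis using assms p by (auto simp: X_mem_block_iff)
  next
    case (Grid a b c i m)
    then show ?thesis using assms p by (auto simp: X_mem_block_iff Grid_mem_block_iff)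
  next
    case (Private l'' k)
    then show ?thesis using assms private_block_unique by metis
  qed
next
  case p: (Grid a b c i m)
  show ?thesis
  proof (cases q)
    case (X w)
    then show ?thesis using assms p by (auto simp: X_mem_block_iff Grid_mem_block_iff)
  next
    case (Private l'' k)
    then show ?thesis using assms private_block_unique by metis
  next
    case q: (Grid a' b' c' i' m')
    show ?thesis
      using assms(3-) Suc_neq_div_4 unfolding p q
      by (cases l; cases l')
        (auto simp: Grid_mem_block_iff dest: mod_4_add_right_cancel div_mod_4_add_left_cancel)
  qed
qed

lemma almost_disjoint_blocks: "almost_disjoint 2 blocks"
proof -
  have "finite (A \<inter> B) \<and> card (A \<inter> B) < 2" if AB: "A \<in> blocks" "B \<in> blocks" "A \<noteq> B" for A B
  proof -
    have "p = q" if "p \<in> A \<inter> B" "q \<in> A \<inter> B" for p q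
      using AB that unfolding blocks_def by (auto dest: blocks_meet_at_most_once)
    then have "A \<inter> B = {} \<or> (\<exists>p. A \<inter> B = {p})"
      by blast
    then show ?thesis by auto
  qed
  then show ?thesis unfolding almost_disjoint_def by blast
qed

section \<open>Colour counting\<close>

lemma latin_window_impossible:
  fixes h :: "nat \<Rightarrow> nat \<Rightarrow> nat"
  assumes colours: "\<And>i q. h i q \<in> {c, d, e}"
    and row: "\<And>i q q'. h i q = d \<Longrightarrow> h i q' = d \<Longrightarrow> q = q'"
    and column: "\<And>i i' q. i \<in> {1..3} \<Longrightarrow> i' \<in> {1..3} \<Longrightarrow> q < 4 \<Longrightarrow>
      h i q = e \<Longrightarrow> h i' q = e \<Longrightarrow> i = i'"
    and transversal: "\<And>i q i' q'. i \<in> {1..3} \<Longrightarrow> i' \<in> {1..3} \<Longrightarrow> q < 4 \<Longrightarrow> q' < 4 \<Longrightarrow>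
      (i + q) mod 4 = (i' + q') mod 4 \<Longrightarrow> h i q = c \<Longrightarrow> h i' q' = c \<Longrightarrow> i = i' \<and> q = q'"
  shows False
proof -
  define W where "W = {1..3::nat} \<times> {..<4::nat}"
  define S where "S j = {w \<in> W. h (fst w) (snd w) = j}" for j
  \<comment> \<open>The three classes inject into rows, columns and transversals, leaving room for 3
    + 4 + 4 = 11 of the 12 points.\<close>
  have "card (S d) \<le> card {1..3::nat}"
    by (rule card_inj_on_le[of fst]) (auto simp: S_def W_def inj_on_def intro: row)
  moreover have "card (S e) \<le> card {..<4::nat}"
    by (rule card_inj_on_le[of snd]) (auto simp: S_def W_def inj_on_def intro: column)
  moreover have "card (S c) \<le> card {..<4::nat}"
    by (rule card_inj_on_le[of "\<lambda>w. (fst w + snd w) mod 4"])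
      (auto simp: S_def W_def inj_on_def dest: transversal[rotated 4])
  moreover have "W = S c \<union> S d \<union> S e"
    using colours by (auto simp: S_def)
  then have "card W \<le> card (S c) + card (S d) + card (S e)"
    using card_Un_le[of "S c \<union> S d" "S e"] card_Un_le[of "S c" "S d"] by simp
  ultimately show False by (simp add: W_def)
qed

text \<open>The colour that occurs exactly once is neither \<open>u\<close> nor \<open>v\<close>,
  since each of these has two points in \<open>A\<close>.\<close>

lemma third_colour_unique:
  assumes ex: "\<exists>i<3. card (A \<inter> g -` {i}) = 1"
    and "{u, v, w} = {0, 1, 2::nat}"
    and u: "p \<in> A" "p' \<in> A" "p \<noteq> p'" "g p = u" "g p' = u"
    and v: "q \<in> A" "q' \<in> A" "q \<noteq> q'" "g q = v" "g q' = v"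
  shows "\<exists>!r. r \<in> A \<and> g r = w"
proof -
  obtain i where i: "i < 3" "card (A \<inter> g -` {i}) = 1" using ex by blast
  then obtain r where r: "A \<inter> g -` {i} = {r}" by (auto simp: card_1_singleton_iff)
  have fibre: "s \<in> A \<and> g s = i \<longleftrightarrow> s = r" for s
    using r by (simp add: set_eq_iff)
  then have "i \<noteq> u" "i \<noteq> v" using u v by metis+
  moreover have "i \<in> {u, v, w}" using i assms(2) by auto
  ultimately have "i = w" by simp
  with fibre show ?thesis by metis
qed

lemma no_extension:
  assumes cf: "conflict_free 3 g blocks" and ext: "\<forall>p\<in>dom precolouring. precolouring p = Some (g p)"
  shows False
proof -
  have lt: "g p < 3" for p using cf by (simp add: conflict_free_def)
  have precoloured: "g (Private l k) = private_colour l k" if "valid_block l" "k < 3" for l k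
    using ext[rule_format, of "Private l k"] that by (auto simp: dom_def)
  have uniq: "\<exists>i<3. card (block_points l \<inter> g -` {i}) = 1" if "valid_block l" for l
    using cf that by (auto simp: conflict_free_def blocks_def)
  have "\<not> inj_on (g \<circ> X) {..<4}"
  proof
    assume "inj_on (g \<circ> X) {..<4}"
    then have "card {..<4::nat} \<le> card {..<3::nat}"
      by (rule card_inj_on_le) (auto simp: lt)
    then show False by simp
  qed
  then obtain a b where ab: "a < b" "g (X a) = g (X b)"
    unfolding inj_on_def by (metis comp_apply linorder_neqE_nat)
  define c where "c = g (X a)"
  define d where "d = (c + 1) mod 3"
  define e where "e = (c + 2) mod 3"
  have c: "c < 3" "g (X a) = c" "g (X b) = c" using ab lt by (auto simp: c_def)
  then have "c = 0 \<or> c = 1 \<or> c = 2" by auto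
  then have perm: "{c, e, d} = {0, 1, 2}" "{c, d, e} = {0, 1, 2}" "{d, e, c} = {0, 1, 2}"
    and distinct: "c \<noteq> d" "d \<noteq> e" "c \<noteq> e"
    by (auto simp: d_def e_def)
  let ?P = "\<lambda>l k. Private l k"
  have row: "\<exists>!r. r \<in> block_points (Row a b c i) \<and> g r = d" for i
  proof -
    let ?l = "Row a b c i"
    show ?thesis
      by (rule third_colour_unique[OF uniq perm(1), of ?l "X a" "?P ?l 0" "?P ?l 1" "?P ?l 2"])
        (use ab c precoloured[of ?l] in \<open>simp_all add: e_def\<close>)
  qed
  have column: "\<exists>!r. r \<in> block_points (Col a b c n) \<and> g r = e" for n
  proof -
    let ?l = "Col a b c n"
    show ?thesis
      by (rule third_colour_unique[OF uniq perm(2), of ?l "X b" "?P ?l 0" "?P ?l 1" "?P ?l 2"])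
        (use ab c precoloured[of ?l] in \<open>simp_all add: d_def\<close>)
  qed
  obtain r where r: "r \<in> block_points (Row a b c 0)" "g r = d"
    using row by blast
  \<comment> \<open>\<open>X a\<close> and the private points of the row have colours
    \<open>c\<close> and \<open>e\<close>, so \<open>r\<close> lies in the grid.\<close>
  then obtain n where n: "g (Grid a b c 0 n) = d"
    using ab c distinct precoloured[of "Row a b c 0"] by (auto simp: e_def d_def split: if_splits)
  have transversal: "\<exists>!r. r \<in> block_points (Trans a b c n k) \<and> g r = c" for k
  proof -
    let ?l = "Trans a b c n k"
    show ?thesis
      by (rule third_colour_unique[OF uniq perm(3), of ?l "Grid a b c 0 n" "?P ?l 0" "?P ?l 1" "?P ?l 2"])
        (use ab c n precoloured[of ?l] in \<open>simp_all add: d_def e_def\<close>)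
  qed
  \<comment> \<open>For \<open>q < 4\<close> these are the window columns of \<open>n\<close>.
    Dropping the multiple \<open>4 * n\<close> does not change the transversal index.\<close>
  define h where "h i q = g (Grid a b c i (Suc (4 * n + q)))" for i q
  have window: "Grid a b c i (Suc (4 * n + q)) \<in> block_points (Trans a b c n ((i + q) mod 4))"
    if "i \<in> {1..3}" "q < 4" for i q
  proof -
    have "(i + (4 * n + q)) mod 4 = (i + q + n * 4) mod 4" by (simp add: algebra_simps)
    also have "\<dots> = (i + q) mod 4" by (rule mod_mult_self1)
    finally show ?thesis using that by (simp add: Grid_mem_block_iff)
  qed
  show False
  proof (rule latin_window_impossible[of h c d e])
    show "h i q \<in> {c, d, e}" for i q
      using lt[of "Grid a b c i (Suc (4 * n + q))"] perm(2) by (auto simp: h_def)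
    show "q = q'" if "h i q = d" "h i q' = d" for i q q'
    proof -
      have "Grid a b c i (Suc (4 * n + s)) \<in> block_points (Row a b c i)" for s
        by (simp add: Grid_mem_block_iff)
      then have "Grid a b c i (Suc (4 * n + q)) = Grid a b c i (Suc (4 * n + q'))"
        using row[of i] that unfolding h_def by blast
      then show ?thesis by simp
    qed
    show "i = i'" if "i \<in> {1..3}" "i' \<in> {1..3}" "q < 4" "h i q = e" "h i' q = e" for i i' q
    proof -
      let ?m = "Suc (4 * n + q)"
      have "Grid a b c s ?m \<in> block_points (Col a b c ?m)" if "s \<in> {1..3}" for s
        using that by (simp add: Grid_mem_block_iff)
      then have "Grid a b c i ?m = Grid a b c i' ?m"
        using column[of ?m] that unfolding h_def by blast
      then show ?thesis by simp
    qed
    show "i = i' \<and> q = q'" if "i \<in> {1..3}" "i' \<in> {1..3}" "q < 4" "q' < 4"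
      "(i + q) mod 4 = (i' + q') mod 4" "h i q = c" "h i' q' = c" for i q i' q'
    proof -
      have "Grid a b c i (Suc (4 * n + q)) = Grid a b c i' (Suc (4 * n + q'))"
        using transversal[of "(i + q) mod 4"] window[OF that(1,3)] window[OF that(2,4)] that(6,7)
        unfolding h_def that(5) by blast
      then show ?thesis by simp
    qed
  qed
qed

theorem theorem7p7:
  shows "\<not> arrow_omega 2 3 3"
proof (rule not_arrow_omegaI[of blocks 2 precolouring 3 3])
  show "infinite A" if "A \<in> blocks" for A
    using that infinite_block by (auto simp: blocks_def)
  show "almost_disjoint 2 blocks" by (rule almost_disjoint_blocks)
  have "private_colour l k < 3" if "valid_block l" for l k
    using that by (cases l) auto
  moreover have "\<exists>l k. valid_block l \<and> j = private_colour l k" if "precolouring p = Some j" for p j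
    using that by (cases p) (auto split: if_splits)
  ultimately show "ran precolouring \<subseteq> {..<3}"
    by (fastforce simp: ran_def)
  show "finite (A \<inter> dom precolouring) \<and> card (A \<inter> dom precolouring) \<le> 3" if "A \<in> blocks" for A
    using that card_precoloured_block by (auto simp: blocks_def)
qed (rule no_extension)

end
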